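(* Let $s:\mathbf{Z}_{\ge 0}\to\mathbf{Z}$ be a strictly increasing generalized $n$-series over $\mathbf{Z}$ that is not a scalar multiple of the function $n\mapsto[n]_q$ for any $q\in\mathbf{Z}_{>0}$. Then $s(n)=\Omega_a(a^n)$ for all $a\ge 0$.
   Context: A generalized $n$-series over $\mathbf{Z}$ is a function $s:\mathbf{Z}_{\ge 0}\to\mathbf{Z}$ with $s(0)=0$, $s(n)\ne 0$ for all $n>0$, and $s(n-k)\mid s(n)-s(k)$ for all $n>k>0$. Here $[n]_q=\frac{q^n-1}{q-1}=1+q+\cdots+q^{n-1}$, with the convention $[n]_1=n$. The notation $s(n)=\Omega_a(a^n)$ means that there are a constant $c_a>0$ and an integer $N_a$, both allowed to depend on $a$, such that $s(n)\ge c_a a^n$ for all $n\ge N_a$. *)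

theory Defs
  imports Complex_Main
begin

definition generalized_n_series :: "(nat \<Rightarrow> int) \<Rightarrow> bool" where
  "generalized_n_series s \<longleftrightarrow>
     s 0 = 0 \<and> (\<forall>n>0. s n \<noteq> 0) \<and>
     (\<forall>n k. 0 < k \<and> k < n \<longrightarrow> s (n - k) dvd s n - s k)"

text \<open>The polynomial form \<open>1 + q + \<dots> + q^(n-1)\<close> is used as the definition; it
  includes the convention at \<open>q = 1\<close>, and agrees with the quotient otherwise.\<close>

definition q_bracket :: "int \<Rightarrow> nat \<Rightarrow> int" where
  "q_bracket q n = (\<Sum>i<n. q ^ i)"

lemma q_bracket_1: "q_bracket 1 n = int n"
  by (simp add: q_bracket_def)

lemma q_bracket_eq_div:
  assumes "q \<noteq> 1"
  shows "q_bracket q n = (q ^ n - 1) div (q - 1)"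
    and "real_of_int (q_bracket q n) = (real_of_int q ^ n - 1) / (real_of_int q - 1)"
proof -
  have eq: "(q - 1) * q_bracket q n = q ^ n - 1"
    by (simp add: q_bracket_def power_diff_1_eq)
  show "q_bracket q n = (q ^ n - 1) div (q - 1)"
    using assms by (simp flip: eq)
  show "real_of_int (q_bracket q n) = (real_of_int q ^ n - 1) / (real_of_int q - 1)"
    using assms by (simp add: q_bracket_def geometric_sum)
qed

text \<open>One-sided lower bound, without the absolute values of
  \<open>bigomega\<close> from \<open>HOL-Library.Landau_Symbols\<close>. The constants may depend on \<open>g\<close>.\<close>

definition Omega_lower :: "(nat \<Rightarrow> real) \<Rightarrow> (nat \<Rightarrow> real) \<Rightarrow> bool" where
  "Omega_lower f g \<longleftrightarrow> (\<exists>c>0. \<exists>N. \<forall>n\<ge>N. f n \<ge> c * g n)"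

end

theory Submission
  imports Defs
begin

text \<open>Dividing by \<open>s 1\<close>, which divides every value, reduces to \<open>s 1 = 1\<close>. Put \<open>q = s 2 - 1\<close>.
  The axiom with one shift by \<open>1\<close> says that \<open>s (m + 1) = 1 + t * s m\<close> for some integer \<open>t\<close>,
  and compatibility with the shift by \<open>2\<close> forces every such multiplier at \<open>m + 1\<close> to be
  congruent to \<open>q\<close> modulo \<open>s m\<close>. So once \<open>s m\<close> exceeds \<open>q\<close> there are only two options
  (\<open>affine_step_or_jump\<close>): the step \<open>s (m + 2) = 1 + q * s (m + 1)\<close>, which is the recursion of
  the \<open>q\<close>-bracket, or a jump \<open>s (m + 2) \<ge> s m * s (m + 1)\<close>.

  A run of \<open>k\<close> affine steps starting at \<open>m\<close> makes \<open>s (m + k)\<close> congruent to the bracket of \<open>k\<close>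
  modulo \<open>s m\<close>, whereas the axiom makes it congruent to \<open>s k\<close>; when \<open>s m\<close> is large, \<open>s k\<close> must
  be that bracket (\<open>bracket_value_of_affine_run\<close>). If \<open>s\<close> differs from the \<open>q\<close>-bracket
  at some \<open>k\<close>, then far out no run of length \<open>k\<close> exists, so every window of fixed
  length contains a jump and \<open>s\<close> at least squares over it (\<open>eventually_squares\<close>). Since \<open>s\<close> is
  unbounded, this outgrows every exponential.\<close>

section \<open>Elementary facts on generalized n-series and brackets\<close>

lemma generalized_n_series_add_dvd:
  assumes "generalized_n_series s" "0 < m" "0 < k"
  shows "s m dvd s (m + k) - s k"
proof -
  have "s ((m + k) - k) dvd s (m + k) - s k"
    using assms unfolding generalized_n_series_def by (meson less_add_same_cancel2)
  then show ?thesis by simp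
qed

lemma generalized_n_series_first_dvd:
  assumes "generalized_n_series s"
  shows "s 1 dvd s n"
proof (induction n)
  case 0
  then show ?case using assms by (simp add: generalized_n_series_def)
next
  case (Suc n)
  show ?case
  proof (cases "n = 0")
    case False
    then have "s 1 dvd s (1 + n) - s n"
      using assms by (intro generalized_n_series_add_dvd) auto
    then show ?thesis using Suc.IH by (simp add: dvd_diff_left_iff)
  qed simp
qed

lemma generalized_n_series_unscale:
  assumes "generalized_n_series s" "d \<noteq> 0" "\<And>n. s n = d * u n"
  shows "generalized_n_series u"
  using assms unfolding generalized_n_series_def
  by (auto simp flip: right_diff_distrib)

lemma strict_mono_ge_self:
  fixes u :: "nat \<Rightarrow> int"
  assumes "strict_mono u" "u 0 = 0"
  shows "int n \<le> u n"
proof (induction n)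
  case (Suc n)
  then show ?case using strict_monoD[OF assms(1), of n "Suc n"] by simp
qed (simp add: assms)

lemma q_bracket_Suc: "q_bracket q (Suc n) = 1 + q * q_bracket q n"
  unfolding q_bracket_def by (subst sum.lessThan_Suc_shift) (simp add: sum_distrib_left)

lemma affine_run_closed_form:
  assumes "\<And>i. i < k \<Longrightarrow> u (m + i + 1) = 1 + q * u (m + i)"
  shows "u (m + k) = q ^ k * u m + q_bracket q k"
  using assms
proof (induction k)
  case 0
  then show ?case by (simp add: q_bracket_def)
next
  case (Suc k)
  then have "u (m + Suc k) = 1 + q * (q ^ k * u m + q_bracket q k)" by simp
  then show ?case by (simp add: q_bracket_Suc algebra_simps)
qed

section \<open>Affine steps and jumps\<close>

locale normalized_series =
  fixes u :: "nat \<Rightarrow> int" and q :: int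
  assumes series: "generalized_n_series u"
    and mono: "strict_mono u"
    and one: "u 1 = 1"
  defines "q \<equiv> u 2 - 1"
begin

lemma zero: "u 0 = 0"
  using series by (simp add: generalized_n_series_def)

lemma ge_self: "int n \<le> u n"
  by (rule strict_mono_ge_self[OF mono zero])

lemma q_pos: "q > 0"
  using ge_self[of 2] by (simp add: q_def)

lemma succ_eq_affine:
  assumes "m > 0"
  obtains t where "t \<ge> 1" "u (m + 1) = 1 + t * u m"
proof -
  have "u m dvd u (m + 1) - 1"
    using generalized_n_series_add_dvd[OF series assms, of 1] one by simp
  then obtain t where t: "u (m + 1) = 1 + t * u m"
    by (metis dvd_def add.commute diff_add_cancel mult.commute)
  have "u m > 0" using ge_self[of m] assms by simp
  moreover have "t * u m > 0"
    using t one strict_monoD[OF mono, of 1 "m + 1"] assms by simp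
  ultimately have "t \<ge> 1" by (simp add: zero_less_mult_iff)
  then show ?thesis using t that by blast
qed

text \<open>With \<open>u (m + 2) = 1 + t' * u (m + 1)\<close> and \<open>u (m + 1) \<equiv> 1\<close> modulo \<open>u m\<close>, the
  congruence \<open>u (m + 2) \<equiv> u 2\<close> reads \<open>t' \<equiv> q\<close> modulo \<open>u m\<close>. A positive \<open>t'\<close> in this class
  other than \<open>q\<close> is at least \<open>u m\<close>.\<close>

lemma affine_step_or_jump:
  assumes "m > 0" "q \<le> u m"
  shows "u (m + 2) = 1 + q * u (m + 1) \<or> u m * u (m + 1) \<le> u (m + 2)"
proof -
  obtain t where t: "u (m + 1) = 1 + t * u m"
    using succ_eq_affine assms(1) by blast
  obtain t' where t': "t' \<ge> 1" "u (m + 2) = 1 + t' * u (m + 1)"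
    using succ_eq_affine[of "m + 1"] by (auto simp: numeral_2_eq_2)
  have "u (m + 2) - u 2 = (t' - q) + u m * (t' * t)"
    using t t' by (simp add: q_def algebra_simps)
  moreover have "u m dvd u (m + 2) - u 2"
    using generalized_n_series_add_dvd[OF series assms(1), of 2] by simp
  ultimately have "u m dvd t' - q" by (simp add: dvd_add_left_iff)
  then obtain j where j: "t' = q + u m * j"
    by (metis dvd_def add.commute diff_add_cancel)
  have pos: "u m > 0" "u (m + 1) > 0"
    using ge_self[of m] ge_self[of "m + 1"] assms(1) by simp_all
  consider "j = 0" | "j \<ge> 1" | "j \<le> -1" by linarith
  then show ?thesis
  proof cases
    case 1
    then show ?thesis using j t' by simp
  next
    case 2
    then have "u m * 1 \<le> u m * j" using pos by (intro mult_left_mono) auto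
    then have "u m \<le> t'" using j q_pos by simp
    then have "u m * u (m + 1) \<le> t' * u (m + 1)"
      using pos by (intro mult_right_mono) auto
    then show ?thesis using t' by simp
  next
    case 3
    then have "u m * j \<le> u m * (-1)" using pos by (intro mult_left_mono) auto
    then show ?thesis using j t' assms(2) by simp
  qed
qed

text \<open>Iterating the affine recursion gives \<open>u (m + k) = q ^ k * u m + [k]\<close>, so both \<open>u k\<close> and
  the bracket \<open>[k]\<close> are congruent to \<open>u (m + k)\<close> modulo \<open>u m\<close>; the size assumption turns
  the congruence into equality.\<close>

lemma bracket_value_of_affine_run:
  assumes "m > 0" and large: "\<bar>u k - q_bracket q k\<bar> < u m"
    and run: "\<And>i. i < k \<Longrightarrow> u (m + i + 1) = 1 + q * u (m + i)"
  shows "u k = q_bracket q k"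
proof (cases "k = 0")
  case True
  then show ?thesis by (simp add: zero q_bracket_def)
next
  case False
  then have "u m dvd u (m + k) - u k"
    using generalized_n_series_add_dvd[OF series assms(1)] by simp
  also have "u (m + k) - u k = u m * q ^ k - (u k - q_bracket q k)"
    using affine_run_closed_form[of k u m q] run by simp
  finally have "u m dvd u k - q_bracket q k" by (simp add: dvd_diff_right_iff)
  then show ?thesis using large zdvd_not_zless[of "\<bar>u k - q_bracket q k\<bar>" "u m"]
    by (cases "u k = q_bracket q k") auto
qed

text \<open>One value differing from the bracket excludes all long affine runs far out, so a jump
  occurs among any \<open>k\<close> consecutive steps; monotonicity turns it into a squaring over
  \<open>k + 1\<close> indices.\<close>

lemma eventually_squares:
  assumes "u k \<noteq> q_bracket q k"
  obtains M where "\<And>m. M \<le> m \<Longrightarrow> u m * u m \<le> u (m + (k + 1))"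
proof
  define M where "M = nat (q + \<bar>u k - q_bracket q k\<bar> + 1)"
  fix m
  assume "M \<le> m"
  then have "q + \<bar>u k - q_bracket q k\<bar> + 1 \<le> u m"
    using ge_self[of m] unfolding M_def by linarith
  moreover have le: "u i \<le> u j" if "i \<le> j" for i j
    using that mono by (simp add: strict_mono_less_eq)
  moreover have m: "m > 0" using \<open>M \<le> m\<close> q_pos unfolding M_def by linarith
  ultimately have large: "q \<le> u (m + i)" "\<bar>u k - q_bracket q k\<bar> < u (m + 1)" for i
    using le[of m "m + i"] le[of m "m + 1"] q_pos by linarith+
  \<comment> \<open>The run starts at \<open>m + 1\<close>, since the alternative at \<open>m + i\<close> concerns the step
    from \<open>m + 1 + i\<close> to \<open>m + 2 + i\<close>.\<close>
  obtain i where i: "i < k" "u ((m + 1) + i + 1) \<noteq> 1 + q * u ((m + 1) + i)"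
    using bracket_value_of_affine_run[of "m + 1" k] large assms by auto
  have "u (m + i) * u (m + i + 1) \<le> u (m + i + 2)"
    using affine_step_or_jump[of "m + i"] m large(1) i(2) by (simp add: add_ac)
  moreover have "u m * u m \<le> u (m + i) * u (m + i + 1)"
    using ge_self[of m] ge_self[of "m + i"] by (intro mult_mono le) auto
  moreover have "u (m + i + 2) \<le> u (m + (k + 1))" using i by (intro le) simp
  ultimately show "u m * u m \<le> u (m + (k + 1))" by linarith
qed

end

section \<open>Growth faster than every exponential\<close>

lemma exponential_lower_bound_of_window_growth:
  fixes f :: "nat \<Rightarrow> real"
  assumes "a \<ge> 1" "L > 0"
    and ge_1: "\<And>n. M \<le> n \<Longrightarrow> 1 \<le> f n"
    and growth: "\<And>n. M \<le> n \<Longrightarrow> a ^ L * f n \<le> f (n + L)"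
  shows "Omega_lower f (\<lambda>n. a ^ n)"
proof -
  \<comment> \<open>The factor \<open>a ^ (M + L)\<close> absorbs the initial window, where only \<open>1 \<le> f n\<close> is known.\<close>
  have bound: "a ^ n \<le> a ^ (M + L) * f n" if "M \<le> n" for n
    using that
  proof (induction n rule: less_induct)
    case (less n)
    show ?case
    proof (cases "n < M + L")
      case True
      then have "a ^ n \<le> a ^ (M + L)" using assms(1) by (intro power_increasing) auto
      also have "\<dots> \<le> a ^ (M + L) * f n" using ge_1[OF less.prems] assms(1) by simp
      finally show ?thesis .
    next
      case False
      define n' where "n' = n - L"
      have n': "n = n' + L" "M \<le> n'" "n' < n" using False assms(2) by (auto simp: n'_def)
      have "a ^ n = a ^ L * a ^ n'" by (simp add: n' power_add)
      also have "\<dots> \<le> a ^ L * (a ^ (M + L) * f n')"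
        using less.IH[OF n'(3,2)] assms(1) by (intro mult_left_mono) auto
      also have "\<dots> = a ^ (M + L) * (a ^ L * f n')" by simp
      also have "\<dots> \<le> a ^ (M + L) * f n"
        using growth[OF n'(2)] n'(1) assms(1) by (intro mult_left_mono) auto
      finally show ?thesis .
    qed
  qed
  show ?thesis unfolding Omega_lower_def
  proof (intro exI conjI allI impI)
    show "1 / a ^ (M + L) > 0" using assms(1) by simp
    show "1 / a ^ (M + L) * a ^ n \<le> f n" if "M \<le> n" for n
      using bound[OF that] assms(1) by (simp add: divide_le_eq mult.commute)
  qed
qed

lemma Omega_lower_mono:
  assumes "Omega_lower f g" "\<And>n. f n \<le> f' n" "\<And>n. g' n \<le> g n"
  shows "Omega_lower f' g'"
proof -
  obtain c N where c: "c > 0" "\<And>n. n \<ge> N \<Longrightarrow> c * g n \<le> f n"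
    using assms(1) unfolding Omega_lower_def by blast
  have "c * g' n \<le> f' n" if "n \<ge> N" for n
    using c(2)[OF that] assms(2)[of n] mult_left_mono[OF assms(3)[of n], of c] c(1) by linarith
  then show ?thesis using c(1) unfolding Omega_lower_def by blast
qed

lemma (in normalized_series) superexponential:
  assumes "u k \<noteq> q_bracket q k" "a \<ge> 1"
  shows "Omega_lower (\<lambda>n. real_of_int (u n)) (\<lambda>n. a ^ n)"
proof -
  obtain M where M: "\<And>m. M \<le> m \<Longrightarrow> u m * u m \<le> u (m + (k + 1))"
    using eventually_squares[OF assms(1)] by blast
  \<comment> \<open>Beyond \<open>M'\<close> one factor of the square already exceeds \<open>a ^ (k + 1)\<close>.\<close>
  define M' where "M' = max M (nat \<lceil>a ^ (k + 1)\<rceil>)"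
  have large: "a ^ (k + 1) \<le> u n" if "M' \<le> n" for n
  proof -
    have "a ^ (k + 1) \<le> real n" using that unfolding M'_def by linarith
    also have "\<dots> \<le> u n" using ge_self[of n] by linarith
    finally show ?thesis .
  qed
  show ?thesis
  proof (rule exponential_lower_bound_of_window_growth[where L = "k + 1" and M = M'])
    fix n assume n: "M' \<le> n"
    show ge_1: "1 \<le> real_of_int (u n)"
      using large[OF n] one_le_power[OF assms(2), of "k + 1"] by linarith
    have "a ^ (k + 1) * u n \<le> real_of_int (u n) * u n"
      using large[OF n] ge_1 by (intro mult_right_mono) auto
    also have "\<dots> \<le> u (n + (k + 1))"
      using M[of n] n unfolding M'_def by (simp flip: of_int_mult)
    finally show "a ^ (k + 1) * u n \<le> u (n + (k + 1))" .
  qed (use assms in auto)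
qed

theorem theorem3p3p1:
  fixes s :: "nat \<Rightarrow> int"
  assumes "generalized_n_series s"
    and "strict_mono s"
    and "\<And>q :: int. q > 0 \<Longrightarrow> \<not> (\<exists>c :: int. \<forall>n. s n = c * q_bracket q n)"
  shows "\<forall>a :: real. a \<ge> 0 \<longrightarrow> Omega_lower (\<lambda>n. real_of_int (s n)) (\<lambda>n. a ^ n)"
proof (intro allI impI)
  fix a :: real
  assume "a \<ge> 0"
  define u where "u n = s n div s 1" for n
  have s0: "s 0 = 0" using assms(1) by (simp add: generalized_n_series_def)
  then have pos: "s 1 > 0" using strict_monoD[OF assms(2), of 0 1] by simp
  have su: "s n = s 1 * u n" for n
    unfolding u_def using generalized_n_series_first_dvd[OF assms(1)] by simp
  interpret normalized_series u "u 2 - 1"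
  proof unfold_locales
    show "generalized_n_series u"
      using generalized_n_series_unscale[OF assms(1) _ su] pos by simp
    show "strict_mono u"
    proof (rule strict_monoI)
      fix i j :: nat assume "i < j"
      then have "s 1 * u i < s 1 * u j"
        using strict_monoD[OF assms(2)] su by metis
      then show "u i < u j" using pos by (simp add: mult_less_cancel_left_pos)
    qed
    show "u 1 = 1" using pos by (simp add: u_def)
  qed
  obtain k where "u k \<noteq> q_bracket (u 2 - 1) k"
    using assms(3)[OF q_pos] su by metis
  then have "Omega_lower (\<lambda>n. real_of_int (u n)) (\<lambda>n. (max a 1) ^ n)"
    by (rule superexponential) simp
  then show "Omega_lower (\<lambda>n. real_of_int (s n)) (\<lambda>n. a ^ n)"
  proof (rule Omega_lower_mono)
    fix n
    have "1 * u n \<le> s 1 * u n" using pos ge_self[of n] by (intro mult_right_mono) auto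
    then show "real_of_int (u n) \<le> real_of_int (s n)" by (simp only: su[of n] mult_1 of_int_le_iff)
    show "a ^ n \<le> (max a 1) ^ n" using \<open>a \<ge> 0\<close> by (intro power_mono) auto
  qed
qed

end
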